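(* For every $B>0$ there is a constant $K>0$ depending only on $B$, and for every integer $d\ge 1$ there is a function $\eta$ assigning a positive number $\eta(A)>0$ to each $A\subseteq[d]\times[d]$ for which $([d],A)$ is an acyclic directed graph, such that the following holds. Let $T\ge 1$, let $w^*\in\mathbb{R}^d$ have pairwise distinct components, let $X_1,\dots,X_T\subseteq\mathbb{Z}^d$ be M-convex sets with $\max\{\langle w^*,x-x'\rangle : x,x'\in X_t\}\le B$ for all $t$, and let $x_t\in\arg\max_{x\in X_t}\langle w^*,x\rangle$ for all $t\in[T]$ (uncorrupted feedback). Then every run of the center-of-gravity version of Algorithm 1 (described in the context, with perturbation size in round $t$ at most $\eta(A_t)$) satisfies $$R_T=\sum_{t=1}^T\langle w^*,x_t-\hat x_t\rangle\le K\,d\log d .$$ That is, $R_T=O(d\log d)$, independently of $T$.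
   Context: Notation: $[d]=\{1,\dots,d\}$; $x(i)$ is the $i$th component of $x\in\mathbb{R}^d$; $\mathbf{e}_i$ is the $i$th standard basis vector; $\langle\cdot,\cdot\rangle$ is the standard inner product. M-convex set: a non-empty set $X\subseteq\mathbb{Z}^d$ such that for any $x,y\in X$ and $i\in[d]$ with $x(i)>y(i)$ there is $j\in[d]$ with $x(j)<y(j)$, $x-\mathbf{e}_i+\mathbf{e}_j\in X$ and $y+\mathbf{e}_i-\mathbf{e}_j\in X$. Online inverse linear optimization: an agent has a hidden vector $w^*\in\mathbb{R}^d$. In each round $t=1,\dots,T$ the learner computes $\hat w_t\in\mathbb{R}^d$ from $(X_s,x_s)_{s<t}$, which suggests an action $\hat x_t\in\arg\max\{\langle\hat w_t,x\rangle : x\in X_t\}$; then the learner observes $X_t$ and the agent's action $x_t\in X_t$. The regret is $R_T=\sum_{t=1}^T\langle w^*,x_t-\hat x_t\rangle$. The sets $X_t$ (and actions $x_t$) may be chosen arbitrarily, possibly adaptively. Algorithm 1, center-of-gravity version: set $A_1=\emptyset$. For $t=1,\dots,T$: let $$P_t=\{w\in[0,1]^d : w(i)\ge w(j)\ \text{for all } (i,j)\in A_t\};$$ let $c_t$ be the center of gravity (centroid with respect to Lebesgue measure) of $P_t$; let $\hat w_t=c_t$ if the components of $c_t$ are distinct, and otherwise let $\hat w_t$ be any point of $P_t$ with pairwise distinct components and Euclidean distance at most $\eta(A_t)$ from $c_t$ (an arbitrarily small tie-breaking perturbation within $P_t$). Then $\hat w_t(i)>\hat w_t(j)$ for all $(i,j)\in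 A_t$. Let $\hat x_t\in\arg\max\{\langle\hat w_t,x\rangle : x\in X_t\}$, observe $x_t$, and set $$A_{t+1}=A_t\cup\{(i,j): i\ne j,\ x_t-\mathbf{e}_i+\mathbf{e}_j\in X_t\}.$$ In this uncorrupted setting the directed graph $([d],A_t)$ (arc $i\to j$ for each $(i,j)\in A_t$) is always acyclic, so $P_t$ has positive volume. *)

theory Defs
  imports "HOL-Analysis.Analysis"
begin

text \<open>
  The dimension d is quantified inside the theorem (below the constant K), so it cannot be
  a type. Vectors of dimension d are functions on nat that are extensional on
  \<open>{1..d}\<close> (value \<open>undefined\<close> elsewhere), which are the points of the
  product measure spaces of the library.
\<close>

definition real_vecs :: "nat \<Rightarrow> (nat \<Rightarrow> real) set" where
  "real_vecs d = {1..d} \<rightarrow>\<^sub>E UNIV"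

definition int_vecs :: "nat \<Rightarrow> (nat \<Rightarrow> int) set" where
  "int_vecs d = {1..d} \<rightarrow>\<^sub>E UNIV"

definition ip :: "nat \<Rightarrow> (nat \<Rightarrow> real) \<Rightarrow> (nat \<Rightarrow> int) \<Rightarrow> real" where
  "ip d w x = (\<Sum>i=1..d. w i * real_of_int (x i))"

text \<open>The vector \<open>x - e\<^sub>i + e\<^sub>j\<close>.\<close>

definition exch :: "nat \<Rightarrow> (nat \<Rightarrow> int) \<Rightarrow> nat \<Rightarrow> nat \<Rightarrow> (nat \<Rightarrow> int)" where
  "exch d x i j = (\<lambda>k\<in>{1..d}. x k - of_bool (k = i) + of_bool (k = j))"

definition M_convex :: "nat \<Rightarrow> (nat \<Rightarrow> int) set \<Rightarrow> bool" where
  "M_convex d X \<longleftrightarrow> X \<noteq> {} \<and> X \<subseteq> int_vecs d \<and>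
     (\<forall>x\<in>X. \<forall>y\<in>X. \<forall>i\<in>{1..d}. x i > y i \<longrightarrow>
        (\<exists>j\<in>{1..d}. x j < y j \<and> exch d x i j \<in> X \<and> exch d y j i \<in> X))"

definition order_polytope :: "nat \<Rightarrow> (nat \<times> nat) set \<Rightarrow> (nat \<Rightarrow> real) set" where
  "order_polytope d A = {w \<in> {1..d} \<rightarrow>\<^sub>E {0..1}. \<forall>(i, j)\<in>A. w i \<ge> w j}"

text \<open>Lebesgue measure on Borel sets; its completion gives the same centroid for the
  closed sets to which it is applied here.\<close>

definition lebesgue_vec :: "nat \<Rightarrow> (nat \<Rightarrow> real) measure" where
  "lebesgue_vec d = (\<Pi>\<^sub>M i\<in>{1..d}. lborel)"

definition centroid :: "nat \<Rightarrow> (nat \<Rightarrow> real) set \<Rightarrow> (nat \<Rightarrow> real)" where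
  "centroid d P = (\<lambda>i\<in>{1..d}.
     (LINT w:P|lebesgue_vec d. w i) / measure (lebesgue_vec d) P)"

text \<open>
  A run over rounds \<open>1..T\<close> with feasible sets X, observed actions x, arc sets A,
  predictions w and suggested actions \<open>xh\<close>. It is a relation because the
  perturbation and the maximizer \<open>xh t\<close> are arbitrary choices.
\<close>

definition cog_run :: "nat \<Rightarrow> ((nat \<times> nat) set \<Rightarrow> real) \<Rightarrow> nat \<Rightarrow>
    (nat \<Rightarrow> (nat \<Rightarrow> int) set) \<Rightarrow> (nat \<Rightarrow> nat \<Rightarrow> int) \<Rightarrow>
    (nat \<Rightarrow> (nat \<times> nat) set) \<Rightarrow> (nat \<Rightarrow> nat \<Rightarrow> real) \<Rightarrow>
    (nat \<Rightarrow> nat \<Rightarrow> int) \<Rightarrow> bool" where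
  "cog_run d \<eta> T X x A w xh \<longleftrightarrow>
     A 1 = {} \<and>
     (\<forall>t\<in>{1..T}.
        (let P = order_polytope d (A t); c = centroid d P in
           if inj_on c {1..d} then w t = c
           else w t \<in> P \<and> inj_on (w t) {1..d} \<and>
                L2_set (\<lambda>i. w t i - c i) {1..d} \<le> \<eta> (A t)) \<and>
        is_arg_max (ip d (w t)) (\<lambda>y. y \<in> X t) (xh t) \<and>
        A (Suc t) = A t \<union>
          {(i, j). i \<in> {1..d} \<and> j \<in> {1..d} \<and> i \<noteq> j \<and> exch d (x t) i j \<in> X t})"

definition regret :: "nat \<Rightarrow> nat \<Rightarrow> (nat \<Rightarrow> real) \<Rightarrow>
    (nat \<Rightarrow> nat \<Rightarrow> int) \<Rightarrow> (nat \<Rightarrow> nat \<Rightarrow> int) \<Rightarrow> real" where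
  "regret d T ws x xh = (\<Sum>t=1..T. ip d ws (\<lambda>i. x t i - xh t i))"

end

theory Submission
  imports Defs
begin

text \<open>
  The volume of the polytope \<open>P\<^sub>t\<close> is a potential. If \<open>xh t \<noteq> x t\<close>, the exchange axiom
  yields an arc \<open>(i, j)\<close> that is added to \<open>A\<^sub>t\<close> although the prediction has \<open>w i < w j\<close>. A small
  perturbation cannot reverse a strict inequality between coordinates of the centroid, so the
  centroid satisfies \<open>c i \<le> c j\<close>, and the cut \<open>w i \<ge> w j\<close> leaves at most a \<open>3/4\<close> fraction of
  the volume; this constant is independent of the dimension by the Prekopa-Leindler inequality.
  All arcs agree with the order of \<open>w\<^sup>*\<close>, so the volume never drops below \<open>(1/d)\<^sup>d\<close>.
  Hence at most \<open>d ln d / ln (4/3)\<close> rounds incur regret, each at most \<open>B\<close>.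
\<close>

section \<open>The Prekopa-Leindler inequality\<close>

text \<open>The set on the right is \<open>(S + a) / 2\<close>, written as a preimage so that its
  measurability is plain.\<close>

lemma emeasure_lborel_halve:
  fixes S :: "real set"
  assumes [measurable]: "S \<in> sets borel"
  shows "emeasure lborel S = 2 * emeasure lborel {z. 2 * z - a \<in> S}"
proof -
  have "emeasure lborel S = (\<integral>\<^sup>+x. indicator S x \<partial>lborel)"
    by simp
  also have "\<dots> = ennreal \<bar>2\<bar> * (\<integral>\<^sup>+x. indicator S (- a + 2 * x) \<partial>lborel)"
    by (rule nn_integral_real_affine) auto
  also have "(\<integral>\<^sup>+x. indicator S (- a + 2 * x) \<partial>lborel)
      = (\<integral>\<^sup>+x. indicator {z. 2 * z - a \<in> S} x \<partial>lborel)"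
    by (intro nn_integral_cong) (auto simp: indicator_def add.commute)
  also have "\<dots> = emeasure lborel {z. 2 * z - a \<in> S}"
    by simp
  finally show ?thesis by simp
qed

text \<open>Cut \<open>A\<close> at a point \<open>a\<close> near its supremum and \<open>B\<close>
  at a point \<open>b\<close> near its infimum, each at a cost of at most \<open>e / 2\<close>. Then
  \<open>(A' + b) / 2\<close> and \<open>(a + B') / 2\<close> are disjoint subsets of
  \<open>C\<close> with half the measures of \<open>A'\<close> and \<open>B'\<close>.\<close>

lemma emeasure_midpoint_bounded:
  fixes A B C :: "real set"
  assumes [measurable]: "A \<in> sets borel" "B \<in> sets borel" "C \<in> sets borel"
    and ne: "A \<noteq> {}" "B \<noteq> {}" and bd: "bdd_above A" "bdd_below B"
    and mid: "\<And>x y. x \<in> A \<Longrightarrow> y \<in> B \<Longrightarrow> (x + y) / 2 \<in> C"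
  shows "emeasure lborel A + emeasure lborel B \<le> 2 * emeasure lborel C"
proof (rule ennreal_le_epsilon)
  fix e :: real assume "e > 0"
  obtain a where a: "a \<in> A" "Sup A - e / 2 < a"
    using less_cSupD[OF ne(1), of "Sup A - e / 2"] \<open>e > 0\<close> by auto
  obtain b where b: "b \<in> B" "b < Inf B + e / 2"
    using cInf_lessD[OF ne(2), of "Inf B + e / 2"] \<open>e > 0\<close> by auto
  define A' where "A' = A \<inter> {..<a}"
  define B' where "B' = B \<inter> {b<..}"
  have [measurable]: "A' \<in> sets borel" "B' \<in> sets borel"
    unfolding A'_def B'_def by auto
  have "emeasure lborel A \<le> emeasure lborel (A' \<union> {a..Sup A})"
    by (intro emeasure_mono) (auto simp: A'_def not_le bd cSup_upper)
  also have "\<dots> \<le> emeasure lborel A' + emeasure lborel {a..Sup A}"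
    by (intro emeasure_subadditive) auto
  also have "emeasure lborel {a..Sup A} \<le> ennreal (e / 2)"
    using a bd \<open>e > 0\<close> by (auto simp: cSup_upper intro!: ennreal_leI)
  finally have 1: "emeasure lborel A \<le> emeasure lborel A' + ennreal (e / 2)" by simp
  have "emeasure lborel B \<le> emeasure lborel (B' \<union> {Inf B..b})"
    by (intro emeasure_mono) (auto simp: B'_def not_le bd cInf_lower)
  also have "\<dots> \<le> emeasure lborel B' + emeasure lborel {Inf B..b}"
    by (intro emeasure_subadditive) auto
  also have "emeasure lborel {Inf B..b} \<le> ennreal (e / 2)"
    using b bd \<open>e > 0\<close> by (auto simp: cInf_lower intro!: ennreal_leI)
  finally have 2: "emeasure lborel B \<le> emeasure lborel B' + ennreal (e / 2)" by simp
  \<comment> \<open>The translates \<open>A' + b\<close> and \<open>a + B'\<close> lie on different sides of \<open>a + b\<close>.\<close>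
  have "emeasure lborel A' + emeasure lborel B'
      = 2 * (emeasure lborel {z. 2 * z - b \<in> A'} + emeasure lborel {z. 2 * z - a \<in> B'})"
    by (simp add: emeasure_lborel_halve[of A' b] emeasure_lborel_halve[of B' a] distrib_left)
  also have "emeasure lborel {z. 2 * z - b \<in> A'} + emeasure lborel {z. 2 * z - a \<in> B'}
      = emeasure lborel ({z. 2 * z - b \<in> A'} \<union> {z. 2 * z - a \<in> B'})"
    by (intro plus_emeasure) (auto simp: A'_def B'_def)
  also have "\<dots> \<le> emeasure lborel C"
  proof (intro emeasure_mono subsetI)
    fix z assume "z \<in> {z. 2 * z - b \<in> A'} \<union> {z. 2 * z - a \<in> B'}"
    then show "z \<in> C"
      using mid[of "2 * z - b" b] mid[of a "2 * z - a"] a b by (auto simp: A'_def B'_def)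
  qed auto
  finally have 3: "emeasure lborel A' + emeasure lborel B' \<le> 2 * emeasure lborel C"
    by (simp add: mult_left_mono)
  have "emeasure lborel A + emeasure lborel B
      \<le> (emeasure lborel A' + emeasure lborel B') + (ennreal (e / 2) + ennreal (e / 2))"
    using add_mono[OF 1 2] by (simp add: ac_simps)
  also have "ennreal (e / 2) + ennreal (e / 2) = ennreal e"
    using \<open>e > 0\<close> by (simp flip: ennreal_plus)
  finally show "emeasure lborel A + emeasure lborel B \<le> 2 * emeasure lborel C + ennreal e"
    using 3 by (meson add_mono order_refl order_trans)
qed

text \<open>Truncating \<open>A\<close> from above and \<open>B\<close> from below reduces this to
  the bounded case, by continuity of measure from below. The thresholds start at points of
  \<open>A\<close> and \<open>B\<close>, so that no truncation is empty.\<close>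

lemma emeasure_midpoint:
  fixes A B C :: "real set"
  assumes [measurable]: "A \<in> sets borel" "B \<in> sets borel" "C \<in> sets borel"
    and ne: "A \<noteq> {}" "B \<noteq> {}"
    and mid: "\<And>x y. x \<in> A \<Longrightarrow> y \<in> B \<Longrightarrow> (x + y) / 2 \<in> C"
  shows "emeasure lborel A + emeasure lborel B \<le> 2 * emeasure lborel C"
proof -
  obtain a b where ab: "a \<in> A" "b \<in> B" using ne by blast
  define A' where "A' n = A \<inter> {..a + real n}" for n
  define B' where "B' n = B \<inter> {b - real n..}" for n
  have [measurable]: "A' n \<in> sets borel" "B' n \<in> sets borel" for n
    unfolding A'_def B'_def by auto
  have inc: "incseq A'" "incseq B'"
    by (auto simp: incseq_def A'_def B'_def)
  have "(\<Union>n. A' n) = A"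
  proof -
    have "\<exists>n. x \<le> a + real n" for x
      using real_arch_simple[of "x - a"] by (auto simp: algebra_simps)
    then show ?thesis by (auto simp: A'_def)
  qed
  moreover have "(\<Union>n. B' n) = B"
  proof -
    have "\<exists>n. b - real n \<le> x" for x
      using real_arch_simple[of "b - x"] by (auto simp: algebra_simps)
    then show ?thesis by (auto simp: B'_def)
  qed
  ultimately have "emeasure lborel A + emeasure lborel B
      = (SUP n. emeasure lborel (A' n)) + (SUP n. emeasure lborel (B' n))"
    using SUP_emeasure_incseq[of A' lborel, OF _ inc(1)] SUP_emeasure_incseq[of B' lborel, OF _ inc(2)]
    by (simp add: image_subset_iff)
  also have "\<dots> = (SUP n. emeasure lborel (A' n) + emeasure lborel (B' n))"
  proof (rule ennreal_SUP_add[symmetric])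
    show "incseq (\<lambda>n. emeasure lborel (A' n))" "incseq (\<lambda>n. emeasure lborel (B' n))"
      using inc by (auto simp: mono_def subset_eq intro!: emeasure_mono)
  qed
  also have "\<dots> \<le> 2 * emeasure lborel C"
  proof (intro SUP_least emeasure_midpoint_bounded)
    show "A' n \<noteq> {}" "B' n \<noteq> {}" for n using ab by (auto simp: A'_def B'_def)
    show "bdd_above (A' n)" "bdd_below (B' n)" for n by (auto simp: A'_def B'_def)
  qed (auto simp: A'_def B'_def mid)
  finally show ?thesis .
qed

section \<open>The Prekopa-Leindler inequality on the line\<close>

text \<open>Tonelli's theorem for the region \<open>0 < t < f x\<close> below the graph, whose fibre
  over \<open>x\<close> has length \<open>f x\<close>, also where \<open>f x\<close> is
  infinite.\<close>

lemma (in sigma_finite_measure) nn_integral_layer_cake: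
  assumes [measurable]: "f \<in> borel_measurable M"
  shows "(\<integral>\<^sup>+x. f x \<partial>M)
    = (\<integral>\<^sup>+t. indicator {0<..} t * emeasure M {x \<in> space M. ennreal t < f x} \<partial>lborel)"
proof -
  interpret pair_sigma_finite M lborel ..
  have "f x = (\<integral>\<^sup>+t. indicator {t. 0 < t \<and> ennreal t < f x} t \<partial>lborel)" for x
  proof (cases "f x")
    case (real r)
    then have "{t. 0 < t \<and> ennreal t < f x} = {0<..<r}"
      by (auto simp: ennreal_less_iff)
    with real show ?thesis by simp
  next
    case top
    then have "{t. 0 < t \<and> ennreal t < f x} = {0::real<..}" by auto
    moreover have "emeasure lborel {0::real<..} = \<infinity>"
    proof -
      have "of_nat n \<le> emeasure lborel {0::real<..}" for n
        using emeasure_mono[of "{0<..real n}" "{0<..}" lborel]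
        by (simp add: ennreal_of_nat_eq_real_of_nat subset_eq)
      then show ?thesis
        by (metis ennreal_SUP_of_nat_eq_top SUP_least infinity_ennreal_def top.extremum_unique)
    qed
    ultimately show ?thesis using top by simp
  qed
  then have "(\<integral>\<^sup>+x. f x \<partial>M)
      = (\<integral>\<^sup>+x. (\<integral>\<^sup>+t. indicator {t. 0 < t \<and> ennreal t < f x} t \<partial>lborel) \<partial>M)"
    by simp
  also have "\<dots> = (\<integral>\<^sup>+t. (\<integral>\<^sup>+x. indicator {t. 0 < t \<and> ennreal t < f x} t \<partial>M) \<partial>lborel)"
    by (rule Fubini'[symmetric]) measurable
  also have "\<dots> = (\<integral>\<^sup>+t. indicator {0<..} t * emeasure M {x \<in> space M. ennreal t < f x} \<partial>lborel)"
  proof (rule nn_integral_cong)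
    fix t :: real
    have "(\<integral>\<^sup>+x. indicator {t. 0 < t \<and> ennreal t < f x} t \<partial>M)
       = (\<integral>\<^sup>+x. indicator {0<..} t * indicator {x \<in> space M. ennreal t < f x} x \<partial>M)"
      by (intro nn_integral_cong) (auto simp: indicator_def)
    then show "(\<integral>\<^sup>+x. indicator {t. 0 < t \<and> ennreal t < f x} t \<partial>M)
      = indicator {0<..} t * emeasure M {x \<in> space M. ennreal t < f x}"
      by (simp add: nn_integral_cmult)
  qed
  finally show ?thesis .
qed

text \<open>When both suprema are 1, the sets \<open>f > t\<close> and \<open>g > t\<close> are
  non-empty for \<open>0 < t < 1\<close>, and their midpoints lie in \<open>h > t\<close>.
  Brunn-Minkowski on each level, integrated over \<open>t\<close>, gives this additive form.\<close>

lemma prekopa_leindler_real_normalized: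
  fixes f g h :: "real \<Rightarrow> ennreal"
  assumes [measurable]: "f \<in> borel_measurable borel" "g \<in> borel_measurable borel"
      "h \<in> borel_measurable borel"
    and le1: "\<And>x. f x \<le> 1" "\<And>x. g x \<le> 1"
    and sup: "\<And>t. t < 1 \<Longrightarrow> \<exists>x. t < f x" "\<And>t. t < 1 \<Longrightarrow> \<exists>x. t < g x"
    and mid: "\<And>x y. f x * g y \<le> (h ((x + y) / 2))\<^sup>2"
  shows "(\<integral>\<^sup>+x. f x \<partial>lborel) + (\<integral>\<^sup>+x. g x \<partial>lborel) \<le> 2 * (\<integral>\<^sup>+x. h x \<partial>lborel)"
proof -
  let ?L = "\<lambda>f t. indicator {0<..} t * emeasure lborel {x::real. ennreal t < f x}"
  have cake: "(\<integral>\<^sup>+x. u x \<partial>lborel) = (\<integral>\<^sup>+t. ?L u t \<partial>lborel)"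
    if "u \<in> borel_measurable borel" for u :: "real \<Rightarrow> ennreal"
    using lborel.nn_integral_layer_cake[of u] that by simp
  have [measurable]: "?L u \<in> borel_measurable borel" if [measurable]: "u \<in> borel_measurable borel" for u
    by measurable
  have "?L f t + ?L g t \<le> 2 * ?L h t" for t
  proof -
    consider "t \<le> 0" | "t \<ge> 1" | "0 < t" "t < 1" by linarith
    then show ?thesis
    proof cases
      \<comment> \<open>From level 1 on, the superlevel sets of \<open>f\<close> and
        \<open>g\<close> are empty. Brunn-Minkowski does not apply to them, but the left side is
        0.\<close>
      case 2
      then have "\<not> ennreal t < f x" "\<not> ennreal t < g x" for x
        using le1[of x] by (meson leD ennreal_ge_1 order_trans)+
      then show ?thesis by simp
    next
      case 3
      have "ennreal t < 1" using 3 by (simp add: ennreal_less_one_iff)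
      have "emeasure lborel {x. ennreal t < f x} + emeasure lborel {x. ennreal t < g x}
          \<le> 2 * emeasure lborel {x. ennreal t < h x}"
      proof (rule emeasure_midpoint)
        fix x y assume *: "x \<in> {x. ennreal t < f x}" "y \<in> {x. ennreal t < g x}"
        have "(ennreal t)\<^sup>2 < ennreal t * g y"
          using * 3 unfolding power2_eq_square by (intro ennreal_mult_strict_left_mono) auto
        also have "\<dots> \<le> f x * g y"
          using * by (intro mult_right_mono) auto
        also have "\<dots> \<le> (h ((x + y) / 2))\<^sup>2" by (rule mid)
        finally show "(x + y) / 2 \<in> {x. ennreal t < h x}"
          using power_mono[of "h ((x + y) / 2)" "ennreal t" 2] by (auto simp: not_le[symmetric])
      qed (use sup \<open>ennreal t < 1\<close> in auto)
      with 3 show ?thesis by simp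
    qed auto
  qed
  then have "(\<integral>\<^sup>+t. ?L f t + ?L g t \<partial>lborel) \<le> (\<integral>\<^sup>+t. 2 * ?L h t \<partial>lborel)"
    by (intro nn_integral_mono)
  then show ?thesis
    unfolding cake[OF assms(1)] cake[OF assms(2)] cake[OF assms(3)]
    by (subst (asm) nn_integral_add, simp, simp, subst (asm) nn_integral_cmult, simp)
qed

text \<open>The inequality of arithmetic and geometric means, which turns the additive bound for
  normalized functions into a product bound.\<close>

lemma ennreal_four_mult_le: "4 * (x * y) \<le> (x + y :: ennreal)\<^sup>2"
proof (cases "x = top \<or> y = top")
  case False
  then obtain a b where ab: "x = ennreal a" "a \<ge> 0" "y = ennreal b" "b \<ge> 0"
    by (metis ennreal_cases)
  have "4 * (a * b) \<le> (a + b)\<^sup>2"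
    using sum_squares_bound[of a b] by (simp add: power2_sum)
  then show ?thesis
    using ab by (simp add: ennreal_mult[symmetric] ennreal_power flip: ennreal_plus ennreal_numeral)
qed (auto simp: power2_eq_square ennreal_mult_top ennreal_top_mult)

text \<open>Divide \<open>f\<close> and \<open>g\<close> by their suprema, apply the additive form,
  and pass to products; the scaling constants then cancel.\<close>

lemma prekopa_leindler_real_bounded:
  fixes f g h :: "real \<Rightarrow> ennreal"
  assumes [measurable]: "f \<in> borel_measurable borel" "g \<in> borel_measurable borel"
      "h \<in> borel_measurable borel"
    and bd: "(SUP x. f x) < top" "(SUP x. g x) < top"
    and mid: "\<And>x y. f x * g y \<le> (h ((x + y) / 2))\<^sup>2"
  shows "(\<integral>\<^sup>+x. f x \<partial>lborel) * (\<integral>\<^sup>+x. g x \<partial>lborel) \<le> (\<integral>\<^sup>+x. h x \<partial>lborel)\<^sup>2"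
proof (cases "(SUP x. f x) = 0 \<or> (SUP x. g x) = 0")
  case True
  then have "(\<forall>x. f x = 0) \<or> (\<forall>x. g x = 0)"
    by (metis SUP_upper UNIV_I le_zero_eq)
  then show ?thesis by auto
next
  case False
  then obtain a b where a: "(SUP x. f x) = ennreal a" "a > 0" and b: "(SUP x. g x) = ennreal b" "b > 0"
    using bd by (cases "SUP x. f x"; cases "SUP x. g x") (auto simp: less_le)
  define F where "F = (\<integral>\<^sup>+x. f x \<partial>lborel)"
  define G where "G = (\<integral>\<^sup>+x. g x \<partial>lborel)"
  define H where "H = (\<integral>\<^sup>+x. h x \<partial>lborel)"
  \<comment> \<open>The geometric mean of \<open>1 / a\<close> and \<open>1 / b\<close>: with this
    factor on \<open>h\<close>, the midpoint hypothesis survives the rescaling.\<close>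
  define r where "r = 1 / sqrt (a * b)"
  have r: "r > 0" "r\<^sup>2 = (1 / a) * (1 / b)"
    using a b by (auto simp: r_def power_divide real_sqrt_mult power_mult_distrib)
  have scale: "(ennreal r * z)\<^sup>2 = ennreal ((1 / a) * (1 / b)) * z\<^sup>2" for z
    using r by (simp add: power_mult_distrib ennreal_power)
  have *: "ennreal (1 / a) * u * (ennreal (1 / b) * v) = ennreal ((1 / a) * (1 / b)) * (u * v)" for u v
    using a b by (subst ennreal_mult) (auto simp: ac_simps)
  have sup: "\<exists>x. t < ennreal (1 / c) * u x" if asms: "t < 1" "(SUP x. u x) = ennreal c" "c > 0"
    for u :: "real \<Rightarrow> ennreal" and c t
  proof -
    have "ennreal c * t < ennreal c * 1"
      using asms by (intro ennreal_mult_strict_left_mono) auto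
    then have "ennreal c * t < (SUP x. u x)"
      by (simp add: asms(2))
    then obtain x where "ennreal c * t < u x"
      by (auto simp: less_SUP_iff)
    then have "ennreal (1 / c) * (ennreal c * t) < ennreal (1 / c) * u x"
      using asms by (intro ennreal_mult_strict_left_mono) auto
    moreover have "ennreal (1 / c) * (ennreal c * t) = t"
      using asms by (simp add: mult.assoc[symmetric] flip: ennreal_mult)
    ultimately show ?thesis by auto
  qed
  have le1: "ennreal (1 / c) * u x \<le> 1" if "(SUP x. u x) = ennreal c" "c > 0"
    for u :: "real \<Rightarrow> ennreal" and c x
  proof -
    have "ennreal (1 / c) * u x \<le> ennreal (1 / c) * ennreal c"
      unfolding that(1)[symmetric] by (intro mult_left_mono SUP_upper) auto
    then show ?thesis using that by (simp flip: ennreal_mult)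
  qed
  have "(\<integral>\<^sup>+x. ennreal (1 / a) * f x \<partial>lborel) + (\<integral>\<^sup>+x. ennreal (1 / b) * g x \<partial>lborel)
      \<le> 2 * (\<integral>\<^sup>+x. ennreal r * h x \<partial>lborel)"
  proof (rule prekopa_leindler_real_normalized)
    show "ennreal (1 / a) * f x * (ennreal (1 / b) * g y) \<le> (ennreal r * h ((x + y) / 2))\<^sup>2" for x y
      unfolding * scale by (intro mult_left_mono mid) auto
  qed (use a b sup le1 in auto)
  then have "ennreal (1 / a) * F + ennreal (1 / b) * G \<le> 2 * (ennreal r * H)"
    by (simp add: nn_integral_cmult F_def G_def H_def)
  then have "(ennreal (1 / a) * F + ennreal (1 / b) * G)\<^sup>2 \<le> (2 * (ennreal r * H))\<^sup>2"
    by (intro power_mono) auto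
  with ennreal_four_mult_le[of "ennreal (1 / a) * F" "ennreal (1 / b) * G"]
  have "4 * (ennreal ((1 / a) * (1 / b)) * (F * G)) \<le> 4 * (ennreal ((1 / a) * (1 / b)) * H\<^sup>2)"
    unfolding * by (simp add: power_mult_distrib[of 2] scale)
  then have "F * G \<le> H\<^sup>2"
    using a b by (simp add: ennreal_mult_le_mult_iff)
  then show ?thesis by (simp add: F_def G_def H_def)
qed

text \<open>Truncating \<open>f\<close> and \<open>g\<close> only lowers the left side of the
  midpoint hypothesis, so \<open>h\<close> can stay as it is. Separate levels \<open>m\<close> and
  \<open>n\<close> let the two suprema be taken one after the other.\<close>

lemma prekopa_leindler_real:
  fixes f g h :: "real \<Rightarrow> ennreal"
  assumes [measurable]: "f \<in> borel_measurable borel" "g \<in> borel_measurable borel"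
      "h \<in> borel_measurable borel"
    and mid: "\<And>x y. f x * g y \<le> (h ((x + y) / 2))\<^sup>2"
  shows "(\<integral>\<^sup>+x. f x \<partial>lborel) * (\<integral>\<^sup>+x. g x \<partial>lborel) \<le> (\<integral>\<^sup>+x. h x \<partial>lborel)\<^sup>2"
proof -
  define trunc where "trunc u n x = min (u x) (of_nat n)" for u :: "real \<Rightarrow> ennreal" and n x
  have [measurable]: "trunc u n \<in> borel_measurable borel" if [measurable]: "u \<in> borel_measurable borel" for u n
    unfolding trunc_def by measurable
  have sup_trunc: "(SUP n. trunc u n x) = u x" for u x
  proof -
    have "(SUP n. inf (u x) (of_nat n)) = inf (u x) (SUP n. of_nat n)"
      by (rule inf_SUP[symmetric])
    then show ?thesis by (simp add: trunc_def inf_min ennreal_SUP_of_nat_eq_top)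
  qed
  have int_trunc: "(\<integral>\<^sup>+x. u x \<partial>lborel) = (SUP n. \<integral>\<^sup>+x. trunc u n x \<partial>lborel)"
    if "u \<in> borel_measurable borel" for u
  proof -
    have "incseq (trunc u)"
      by (auto simp: incseq_def le_fun_def trunc_def min_le_iff_disj)
    from nn_integral_monotone_convergence_SUP[OF this, of lborel] that show ?thesis
      by (simp add: sup_trunc)
  qed
  have bd: "(SUP x. trunc u n x) < top" for u n
    by (rule le_less_trans[of _ "of_nat n"]) (auto simp: trunc_def of_nat_less_top intro!: SUP_least)
  have "(\<integral>\<^sup>+x. trunc f m x \<partial>lborel) * (\<integral>\<^sup>+x. trunc g n x \<partial>lborel) \<le> (\<integral>\<^sup>+x. h x \<partial>lborel)\<^sup>2" for m n
  proof (rule prekopa_leindler_real_bounded)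
    show "trunc f m x * trunc g n y \<le> (h ((x + y) / 2))\<^sup>2" for x y
      by (rule order_trans[OF mult_mono mid]) (auto simp: trunc_def)
  qed (auto simp: bd)
  then show ?thesis
    unfolding int_trunc[OF assms(1)] int_trunc[OF assms(2)]
    by (auto simp: SUP_mult_left_ennreal SUP_mult_right_ennreal intro!: SUP_least)
qed

section \<open>The Prekopa-Leindler inequality in product spaces\<close>

text \<open>Induction on the dimension. For fixed \<open>x\<close> and \<open>y\<close>, the
  inequality on the line in the new coordinate is exactly the midpoint hypothesis for the marginals,
  to which the induction hypothesis applies.\<close>

theorem prekopa_leindler_midpoint:
  fixes f g h :: "('i \<Rightarrow> real) \<Rightarrow> ennreal"
  assumes "finite I"
    and "f \<in> borel_measurable (\<Pi>\<^sub>M i\<in>I. lborel)" "g \<in> borel_measurable (\<Pi>\<^sub>M i\<in>I. lborel)"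
      "h \<in> borel_measurable (\<Pi>\<^sub>M i\<in>I. lborel)"
    and "\<And>x y. x \<in> extensional I \<Longrightarrow> y \<in> extensional I
      \<Longrightarrow> f x * g y \<le> (h (\<lambda>i\<in>I. (x i + y i) / 2))\<^sup>2"
  shows "(\<integral>\<^sup>+x. f x \<partial>(\<Pi>\<^sub>M i\<in>I. lborel)) * (\<integral>\<^sup>+x. g x \<partial>(\<Pi>\<^sub>M i\<in>I. lborel))
    \<le> (\<integral>\<^sup>+x. h x \<partial>(\<Pi>\<^sub>M i\<in>I. lborel))\<^sup>2"
  using assms
proof (induction I arbitrary: f g h rule: finite_induct)
  case empty
  interpret product_sigma_finite "\<lambda>_. lborel" by standard
  show ?case
    using empty(4)[of "\<lambda>_. undefined" "\<lambda>_. undefined"]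
    by (simp add: nn_integral_empty restrict_def)
next
  case (insert i I)
  interpret product_sigma_finite "\<lambda>_. lborel" by standard
  note [measurable] = insert.prems(1-3)
  have meas_fiber: "(\<lambda>t. u (x(i := t))) \<in> borel_measurable borel"
    if [measurable]: "u \<in> borel_measurable (\<Pi>\<^sub>M i\<in>insert i I. lborel)" and "x \<in> extensional I"
    for u :: "('i \<Rightarrow> real) \<Rightarrow> ennreal" and x
  proof -
    have "x \<in> space (\<Pi>\<^sub>M i\<in>I. lborel)" using that by (auto simp: space_PiM PiE_def)
    then have "(\<lambda>t. x(i := t)) \<in> measurable lborel (\<Pi>\<^sub>M i\<in>insert i I. lborel)"
      by (intro measurable_fun_upd[where J=I]) auto
    from measurable_compose[OF this that(1)] show ?thesis by simp
  qed
  have meas_marg: "(\<lambda>x. \<integral>\<^sup>+t. u (x(i := t)) \<partial>lborel) \<in> borel_measurable (\<Pi>\<^sub>M i\<in>I. lborel)"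
    if [measurable]: "u \<in> borel_measurable (\<Pi>\<^sub>M i\<in>insert i I. lborel)" for u :: "('i \<Rightarrow> real) \<Rightarrow> ennreal"
  proof -
    have "(\<lambda>(x, t). u (x(i := t))) \<in> borel_measurable ((\<Pi>\<^sub>M i\<in>I. lborel) \<Otimes>\<^sub>M lborel)"
      by measurable
    then show ?thesis by measurable
  qed
  show ?case
    unfolding product_nn_integral_insert[OF insert.hyps insert.prems(1)]
      product_nn_integral_insert[OF insert.hyps insert.prems(2)]
      product_nn_integral_insert[OF insert.hyps insert.prems(3)]
  proof (rule insert.IH)
    fix x y :: "'i \<Rightarrow> real"
    assume xy: "x \<in> extensional I" "y \<in> extensional I"
    let ?z = "\<lambda>i\<in>I. (x i + y i) / 2"
    show "(\<integral>\<^sup>+t. f (x(i := t)) \<partial>lborel) * (\<integral>\<^sup>+t. g (y(i := t)) \<partial>lborel)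
      \<le> (\<integral>\<^sup>+t. h (?z(i := t)) \<partial>lborel)\<^sup>2"
    proof (rule prekopa_leindler_real)
      fix s t :: real
      have "(\<lambda>k\<in>insert i I. ((x(i := s)) k + (y(i := t)) k) / 2) = ?z(i := (s + t) / 2)"
        using insert.hyps by (auto simp: restrict_def)
      moreover have "x(i := s) \<in> extensional (insert i I)" "y(i := t) \<in> extensional (insert i I)"
        using xy by (auto simp: extensional_def)
      ultimately show "f (x(i := s)) * g (y(i := t)) \<le> (h (?z(i := (s + t) / 2)))\<^sup>2"
        using insert.prems(4) by metis
    qed (use xy in \<open>auto intro!: meas_fiber insert.prems\<close>)
  qed (intro meas_marg insert.prems(1-3))+
qed

section \<open>Cutting a convex set through its centroid\<close>

lemma emeasure_PiM_lborel_cube: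
  "finite I \<Longrightarrow> emeasure (\<Pi>\<^sub>M i\<in>I. lborel) (I \<rightarrow>\<^sub>E {0..1::real}) = 1"
proof -
  interpret product_sigma_finite "\<lambda>_. lborel :: real measure" by standard
  show "finite I \<Longrightarrow> ?thesis" by (subst emeasure_PiM) auto
qed

text \<open>Once the other coordinates are fixed, \<open>w i\<close> is confined to an interval of
  length \<open>e\<close>, and the others range over a cube of volume 1. This makes the tail of
  \<open>w j - w i\<close> Lipschitz.\<close>

lemma emeasure_cube_slab:
  assumes I: "finite I" "i \<in> I" "j \<in> I" "i \<noteq> j" and "e \<ge> 0"
  shows "emeasure (\<Pi>\<^sub>M i\<in>I. lborel)
     {w \<in> I \<rightarrow>\<^sub>E {0..1::real}. s \<le> w j - w i \<and> w j - w i \<le> s + e} \<le> ennreal e"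
proof -
  interpret product_sigma_finite "\<lambda>_. lborel :: real measure" by standard
  define J where "J = I - {i}"
  have J: "I = insert i J" "finite J" "i \<notin> J" "j \<in> J"
    using I by (auto simp: J_def)
  define S where "S = {w \<in> I \<rightarrow>\<^sub>E {0..1::real}. s \<le> w j - w i \<and> w j - w i \<le> s + e}"
  have "S = {w \<in> space (\<Pi>\<^sub>M i\<in>I. lborel). (\<forall>k\<in>I. 0 \<le> w k \<and> w k \<le> 1) \<and> s \<le> w j - w i \<and> w j - w i \<le> s + e}"
    by (auto simp: S_def space_PiM PiE_iff)
  also have "\<dots> \<in> sets (\<Pi>\<^sub>M i\<in>I. lborel)"
    using I by measurable
  finally have S: "S \<in> sets (\<Pi>\<^sub>M i\<in>insert i J. lborel)"
    unfolding J(1) .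
  have "emeasure (\<Pi>\<^sub>M i\<in>I. lborel) S = (\<integral>\<^sup>+w. indicator S w \<partial>(\<Pi>\<^sub>M i\<in>insert i J. lborel))"
    using S by (simp add: J(1))
  also have "\<dots> = (\<integral>\<^sup>+x. (\<integral>\<^sup>+t. indicator S (x(i := t)) \<partial>lborel) \<partial>(\<Pi>\<^sub>M i\<in>J. lborel))"
    using S J by (intro product_nn_integral_insert) auto
  also have "\<dots> \<le> (\<integral>\<^sup>+x. ennreal e * indicator (J \<rightarrow>\<^sub>E {0..1::real}) x \<partial>(\<Pi>\<^sub>M i\<in>J. lborel))"
  proof (rule nn_integral_mono)
    fix x :: "'a \<Rightarrow> real" assume x: "x \<in> space (\<Pi>\<^sub>M i\<in>J. lborel)"
    have "indicator S (x(i := t))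
        \<le> indicator (J \<rightarrow>\<^sub>E {0..1::real}) x * (indicator {x j - s - e..x j - s} t :: ennreal)" for t
      using x J by (auto simp: indicator_def S_def space_PiM PiE_iff split: if_splits)
    then have "(\<integral>\<^sup>+t. indicator S (x(i := t)) \<partial>lborel)
        \<le> (\<integral>\<^sup>+t. indicator (J \<rightarrow>\<^sub>E {0..1::real}) x * (indicator {x j - s - e..x j - s} t :: ennreal) \<partial>lborel)"
      by (intro nn_integral_mono)
    also have "\<dots> = ennreal e * indicator (J \<rightarrow>\<^sub>E {0..1::real}) x"
      using \<open>e \<ge> 0\<close> by (subst nn_integral_cmult) (auto simp: mult.commute)
    finally show "(\<integral>\<^sup>+t. indicator S (x(i := t)) \<partial>lborel) \<le> ennreal e * indicator (J \<rightarrow>\<^sub>E {0..1::real}) x" .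
  qed
  also have "\<dots> = ennreal e"
    using J by (subst nn_integral_cmult_indicator) (auto simp: emeasure_PiM_lborel_cube intro!: sets_PiM_I_finite)
  finally show ?thesis by (simp add: S_def)
qed

text \<open>If \<open>z > N\<close>, all \<open>Suc N\<close> terms equal 1; otherwise the bound for
  \<open>N\<close> already suffices. The lemma serves to bound a function by a sum of indicators of
  its tails.\<close>

lemma le_sum_of_bool_le:
  "z \<le> real N \<Longrightarrow> z \<le> (\<Sum>k<N. of_bool (real k \<le> z))"
proof (induction N)
  case (Suc N)
  show ?case
  proof (cases "z \<le> real N")
    case False
    then have "(\<Sum>k<Suc N. of_bool (real k \<le> z)) = (\<Sum>k<Suc N. 1 :: real)"
      by (intro sum.cong) auto
    then show ?thesis using Suc.prems by simp
  qed (use Suc.IH in \<open>auto simp: add_increasing2\<close>)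
qed simp

text \<open>Log-concavity makes the ratios of successive terms non-increasing, so if the first is at
  most \<open>1 / 2\<close>, all are. A finite geometric sum stays strictly below
  \<open>2 * v 0\<close>.\<close>

lemma log_concave_sum_less:
  fixes v :: "nat \<Rightarrow> real"
  assumes nonneg: "\<And>k. v k \<ge> 0" and anti: "\<And>k. v (Suc k) \<le> v k"
    and lc: "\<And>k. v k * v (Suc (Suc k)) \<le> (v (Suc k))\<^sup>2"
    and start: "v 0 > 0" "v 1 \<le> v 0 / 2"
  shows "(\<Sum>k<N. v k) < 2 * v 0"
proof -
  have half: "v (Suc k) \<le> v k / 2" for k
  proof (induction k)
    case (Suc k)
    show ?case
    proof (cases "v k = 0")
      case True
      then show ?thesis
        using nonneg[of "Suc k"] nonneg[of "Suc (Suc k)"] anti[of k] anti[of "Suc k"] by linarith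
    next
      case False
      then have "v k > 0" using nonneg[of k] by auto
      have "v k * v (Suc (Suc k)) \<le> v (Suc k) * v (Suc k)"
        using lc[of k] by (simp add: power2_eq_square)
      also have "\<dots> \<le> (v k / 2) * v (Suc k)"
        using Suc nonneg by (intro mult_right_mono) auto
      finally show ?thesis using \<open>v k > 0\<close> by (simp add: field_simps)
    qed
  qed (use start in simp)
  have "v k \<le> v 0 / 2 ^ k" for k
  proof (induction k)
    case (Suc k)
    have "v (Suc k) \<le> v k / 2" by (rule half)
    also have "\<dots> \<le> v 0 / 2 ^ k / 2" using Suc by simp
    finally show ?case by (simp add: mult.commute)
  qed simp
  then have "(\<Sum>k<N. v k) \<le> (\<Sum>k<N. v 0 / 2 ^ k)"
    by (intro sum_mono)
  also have "\<dots> = v 0 * (2 - 2 / 2 ^ N)"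
    by (induction N) (auto simp: field_simps)
  also have "\<dots> < 2 * v 0"
    using start by (simp add: algebra_simps)
  finally show ?thesis .
qed

text \<open>
  A dimension-free weak form of Gruenbaum's inequality. With \<open>Y = w j - w i\<close> on \<open>P\<close>,
  the tail \<open>V s = vol {Y \<ge> s}\<close> is midpoint log-concave and continuous. Choose \<open>b\<close> with
  \<open>V (-b) = vol P / 2\<close>; if \<open>V 0 < vol P / 4\<close>, then \<open>V\<close> at least halves over each further step
  of length \<open>b\<close>, and \<open>Y \<le> -b + b \<cdot> #{k. Y \<ge> (k - 1) b}\<close> makes the mean of \<open>Y\<close> negative.
\<close>

lemma centroid_cut:
  fixes P :: "('i \<Rightarrow> real) set" and I :: "'i set"
  defines "M \<equiv> \<Pi>\<^sub>M i\<in>I. (lborel :: real measure)"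
  assumes I: "finite I" "i \<in> I" "j \<in> I" "i \<noteq> j"
    and P[measurable]: "P \<in> sets M" and cube: "P \<subseteq> I \<rightarrow>\<^sub>E {0..1}"
    and conv: "\<And>x y. x \<in> P \<Longrightarrow> y \<in> P \<Longrightarrow> (\<lambda>k\<in>I. (x k + y k) / 2) \<in> P"
    and pos: "measure M P > 0"
    and mean: "(LINT w:P|M. w i) \<le> (LINT w:P|M. w j)"
  shows "measure M {w \<in> P. w i \<ge> w j} \<le> 3 / 4 * measure M P"
proof -
  have P_le: "emeasure M P \<le> 1"
  proof -
    have "emeasure M P \<le> emeasure M (I \<rightarrow>\<^sub>E {0..1})"
      unfolding M_def using I cube by (intro emeasure_mono) (auto intro!: sets_PiM_I_finite)
    then show ?thesis using I by (simp add: M_def emeasure_PiM_lborel_cube)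
  qed
  then have fin: "emeasure M P < \<infinity>" "emeasure M S \<noteq> \<infinity>" if "S \<subseteq> P" for S
    using emeasure_mono[OF that P] by (auto simp: top_unique le_less_trans ennreal_one_less_top)
  have comp[measurable]: "(\<lambda>w. w k) \<in> borel_measurable M" if "k \<in> I" for k
    using that unfolding M_def by measurable
  define S where "S s = {w \<in> P. s \<le> w j - w i}" for s
  have "S s = P \<inter> {w \<in> space M. s \<le> w j - w i}" for s
    using sets.sets_into_space[OF P] by (auto simp: S_def)
  then have S[measurable]: "S s \<in> sets M" for s
    using I by simp
  have S_sub: "S s \<subseteq> P" for s by (auto simp: S_def)
  define V where "V s = measure M (S s)" for s
  have eV: "emeasure M (S s) = ennreal (V s)" for s
    unfolding V_def using fin(2)[OF S_sub] by (intro emeasure_eq_ennreal_measure) auto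
  have V_nonneg: "V s \<ge> 0" for s by (simp add: V_def)
  have V_anti: "V t \<le> V s" if "s \<le> t" for s t
    unfolding V_def using that S fin(2)[OF S_sub]
    by (intro measure_mono_fmeasurable) (auto simp: S_def fmeasurable_def top.not_eq_extremum)
  \<comment> \<open>Used twice: for the continuity that yields the median level \<open>c\<close>,
    and at the end to compare \<open>V e\<close> with \<open>V 0\<close>.\<close>
  have V_lip: "V s \<le> V (s + e) + e" if "e \<ge> 0" for s e
  proof -
    let ?D = "{w \<in> I \<rightarrow>\<^sub>E {0..1::real}. s \<le> w j - w i \<and> w j - w i \<le> s + e}"
    have "?D = {w \<in> space M. (\<forall>k\<in>I. 0 \<le> w k \<and> w k \<le> 1) \<and> s \<le> w j - w i \<and> w j - w i \<le> s + e}"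
      by (auto simp: M_def space_PiM PiE_iff)
    also have "\<dots> \<in> sets M"
      using I by measurable
    finally have D: "?D \<in> sets M" .
    have "emeasure M (S s) \<le> emeasure M (S (s + e) \<union> ?D)"
      using cube by (intro emeasure_mono sets.Un S D) (auto simp: S_def)
    also have "\<dots> \<le> emeasure M (S (s + e)) + emeasure M ?D"
      using D by (intro emeasure_subadditive) auto
    also have "emeasure M ?D \<le> ennreal e"
      unfolding M_def using I that by (rule emeasure_cube_slab)
    finally show ?thesis
      using that V_nonneg by (simp add: eV add_left_mono flip: ennreal_plus)
  qed
  have V_top: "V (-1) = measure M P"
  proof -
    have "S (-1) = P"
    proof -
      have "- 1 \<le> w j - w i" if "w \<in> P" for w
      proof -
        have "0 \<le> w j" "w i \<le> 1"
          using subsetD[OF cube that] I by (auto simp: PiE_iff)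
        then show ?thesis by simp
      qed
      then show ?thesis by (auto simp: S_def)
    qed
    then show ?thesis by (simp add: V_def)
  qed
  \<comment> \<open>Prekopa-Leindler for indicators: midpoints of \<open>S s\<close> and
    \<open>S t\<close> lie in \<open>S ((s + t) / 2)\<close>, as \<open>P\<close> is closed under
    midpoints and \<open>w j - w i\<close> is linear.\<close>
  have V_lc: "V s * V t \<le> (V ((s + t) / 2))\<^sup>2" for s t
  proof -
    have "emeasure M (S s) * emeasure M (S t) \<le> (emeasure M (S ((s + t) / 2)))\<^sup>2"
    proof -
      have "(\<integral>\<^sup>+w. indicator (S s) w \<partial>M) * (\<integral>\<^sup>+w. indicator (S t) w \<partial>M)
          \<le> (\<integral>\<^sup>+w. indicator (S ((s + t) / 2)) w \<partial>M)\<^sup>2"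
        unfolding M_def
      proof (rule prekopa_leindler_midpoint)
        fix x y :: "'i \<Rightarrow> real"
        have "(\<lambda>k\<in>I. (x k + y k) / 2) \<in> S ((s + t) / 2)" if "x \<in> S s" "y \<in> S t"
          using that conv I by (auto simp: S_def field_simps)
        then show "indicator (S s) x * indicator (S t) y
            \<le> (indicator (S ((s + t) / 2)) (\<lambda>k\<in>I. (x k + y k) / 2) :: ennreal)\<^sup>2"
          by (auto simp: indicator_def)
      qed (use I S in \<open>auto simp flip: M_def\<close>)
      then show ?thesis by simp
    qed
    then show ?thesis
      using V_nonneg by (simp add: eV ennreal_power flip: ennreal_mult)
  qed
  have V0: "V 0 \<ge> measure M P / 4"
  proof (rule ccontr)
    assume "\<not> V 0 \<ge> measure M P / 4"
    then have small: "V 0 < measure M P / 4" by simp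
    have "1-lipschitz_on {-1..0} V"
    proof (rule lipschitz_on_leI)
      fix x y :: real assume "x \<le> y"
      then show "dist (V x) (V y) \<le> 1 * dist x y"
        using V_lip[of "y - x" x] V_anti[of x y] by (auto simp: dist_real_def)
    qed auto
    then have "continuous_on {-1..0} V"
      by (rule lipschitz_on_continuous_on)
    then obtain c where c: "-1 \<le> c" "c \<le> 0" "V c = measure M P / 2"
      using IVT2'[of V 0 "measure M P / 2" "-1"] small pos V_top by auto
    define b where "b = - c"
    have "c \<noteq> 0" using c(3) small pos by auto
    with c have b: "b > 0" "V (- b) = measure M P / 2" by (auto simp: b_def)
    \<comment> \<open>On the cube \<open>w j - w i\<close> is at most 1, so \<open>N\<close> steps
      of length \<open>b\<close> starting from \<open>-b\<close> cover all its values above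
      \<open>-b\<close>.\<close>
    obtain N where N: "(1 + b) / b \<le> real N"
      using real_arch_simple by blast
    \<comment> \<open>The samples start at \<open>-b\<close>: \<open>v 0\<close> is half the volume
      of \<open>P\<close>, and \<open>v 1 = V 0\<close> is less than half of \<open>v 0\<close> by
      assumption.\<close>
    define v where "v k = V (real k * b - b)" for k
    have "(\<Sum>k<N. v k) < 2 * v 0"
    proof (rule log_concave_sum_less)
      show "v (Suc k) \<le> v k" for k
        unfolding v_def using b by (intro V_anti) (auto simp: algebra_simps)
      show "v k * v (Suc (Suc k)) \<le> (v (Suc k))\<^sup>2" for k
        using V_lc[of "real k * b - b" "real (Suc (Suc k)) * b - b"] by (simp add: v_def field_simps)
    qed (use b small pos V_nonneg in \<open>auto simp: v_def\<close>)
    then have sum_less: "(\<Sum>k<N. v k) < measure M P"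
      using b by (simp add: v_def)
    have int_comp: "set_integrable M P (\<lambda>w. w k)" if "k \<in> I" for k
      unfolding set_integrable_def
      using that fin(1)[of P] cube
      by (intro integrableI_bounded_set_indicator[where B=1]) (auto simp: PiE_iff subset_iff)
    have int_ind: "integrable M (indicator A :: _ \<Rightarrow> real)" if "A \<subseteq> P" "A \<in> sets M" for A
      using fin(2)[OF that(1)] that(2) by (simp add: integrable_indicator_iff top.not_eq_extremum)
    have "0 \<le> (LINT w:P|M. w j - w i)"
      using mean int_comp I by simp
    also have "\<dots> \<le> (\<integral>w. - b * indicator P w + b * (\<Sum>k<N. indicator (S (real k * b - b)) w) \<partial>M)"
      unfolding set_lebesgue_integral_def
    proof (rule integral_mono)
      show "integrable M (\<lambda>w. indicat_real P w *\<^sub>R (w j - w i))"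
        using set_integral_diff(1)[OF int_comp[OF I(3)] int_comp[OF I(2)]]
        by (simp add: set_integrable_def)
      show "integrable M (\<lambda>w. - b * indicator P w + b * (\<Sum>k<N. indicator (S (real k * b - b)) w))"
        by (intro Bochner_Integration.integrable_add integrable_mult_right
            Bochner_Integration.integrable_sum int_ind S S_sub P order_refl)
      fix w
      show "indicat_real P w *\<^sub>R (w j - w i)
          \<le> - b * indicator P w + b * (\<Sum>k<N. indicator (S (real k * b - b)) w)"
      proof (cases "w \<in> P")
        case True
        define z where "z = (w j - w i + b) / b"
        have "w j \<le> 1" "0 \<le> w i"
          using subsetD[OF cube True] I by (auto simp: PiE_iff)
        then have "z \<le> (1 + b) / b"
          using b by (auto simp: z_def divide_right_mono)
        then have "z \<le> (\<Sum>k<N. of_bool (real k \<le> z))"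
          using N by (intro le_sum_of_bool_le) simp
        also have "\<dots> = (\<Sum>k<N. indicator (S (real k * b - b)) w)"
          using b True by (intro sum.cong) (auto simp: z_def S_def field_simps indicator_def)
        finally show ?thesis
          using True b by (simp add: z_def field_simps)
      qed (use b in \<open>auto simp: sum_nonneg\<close>)
    qed
    \<comment> \<open>The sum is below \<open>2 * v 0\<close>, which is the volume of
      \<open>P\<close>, so the mean would be negative.\<close>
    also have "\<dots> = - b * measure M P + b * (\<Sum>k<N. v k)"
      using int_ind S_sub S P by (simp add: v_def V_def)
    also have "\<dots> < 0"
      using mult_strict_left_mono[OF sum_less b(1)] by simp
    finally show False by simp
  qed
  show ?thesis
  proof (rule field_le_epsilon)
    \<comment> \<open>The hyperplane \<open>w i = w j\<close> belongs to both \<open>?D\<close> and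
      \<open>S 0\<close>. The tail at \<open>e > 0\<close> is disjoint from \<open>?D\<close>, and
      the Lipschitz bound gives \<open>V e \<ge> V 0 - e\<close>.\<close>
    fix e :: real assume "e > 0"
    let ?D = "{w \<in> P. w j \<le> w i}"
    have "?D = P \<inter> {w \<in> space M. w j \<le> w i}"
      using sets.sets_into_space[OF P] by auto
    also have "\<dots> \<in> sets M" using I by simp
    finally have D: "?D \<in> sets M" .
    have "measure M ?D + V e = measure M (?D \<union> S e)"
      unfolding V_def using D S fin(2)[of ?D] fin(2)[OF S_sub] \<open>e > 0\<close>
      by (intro measure_Union[symmetric]) (auto simp: S_def)
    also have "\<dots> \<le> measure M P"
      using D S fin(2)[of P] S_sub by (intro measure_mono_fmeasurable) (auto simp: fmeasurable_def top.not_eq_extremum)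
    finally show "measure M ?D \<le> 3 / 4 * measure M P + e"
      using V_lip[of e 0] V0 \<open>e > 0\<close> by simp
  qed
qed

section \<open>Order polytopes and the regret bound\<close>

text \<open>Real-valued because the potential argument takes its logarithm.\<close>

definition vol :: "nat \<Rightarrow> (nat \<times> nat) set \<Rightarrow> real" where
  "vol d A = measure (lebesgue_vec d) (order_polytope d A)"

lemma order_polytope_subset_cube: "order_polytope d A \<subseteq> {1..d} \<rightarrow>\<^sub>E {0..1}"
  by (auto simp: order_polytope_def)

lemma order_polytope_mono: "A \<subseteq> A' \<Longrightarrow> order_polytope d A' \<subseteq> order_polytope d A"
  by (auto simp: order_polytope_def)

lemma sets_order_polytope:
  assumes "A \<subseteq> {1..d} \<times> {1..d}"
  shows "order_polytope d A \<in> sets (lebesgue_vec d)"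
proof -
  have "finite A" using assms by (rule finite_subset) auto
  have "order_polytope d A = {w \<in> space (lebesgue_vec d).
      (\<forall>k\<in>{1..d}. 0 \<le> w k \<and> w k \<le> 1) \<and> (\<forall>p\<in>A. w (snd p) \<le> w (fst p))}"
    by (auto simp: order_polytope_def lebesgue_vec_def space_PiM PiE_iff)
  also have "\<dots> \<in> sets (lebesgue_vec d)"
  proof (intro sets.sets_Collect_conj sets.sets_Collect_finite_All \<open>finite A\<close>)
    fix p assume "p \<in> A"
    then have "fst p \<in> {1..d}" "snd p \<in> {1..d}" using assms by auto
    then show "{w \<in> space (lebesgue_vec d). w (snd p) \<le> w (fst p)} \<in> sets (lebesgue_vec d)"
      unfolding lebesgue_vec_def by measurable
  qed (auto simp: lebesgue_vec_def)
  finally show ?thesis .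
qed

lemma emeasure_order_polytope:
  assumes "A \<subseteq> {1..d} \<times> {1..d}"
  shows "emeasure (lebesgue_vec d) (order_polytope d A) = ennreal (vol d A)" "vol d A \<le> 1"
proof -
  have "emeasure (lebesgue_vec d) (order_polytope d A)
      \<le> emeasure (lebesgue_vec d) ({1..d} \<rightarrow>\<^sub>E {0..1})"
    unfolding lebesgue_vec_def
    by (intro emeasure_mono order_polytope_subset_cube sets_PiM_I_finite) auto
  then have le: "emeasure (lebesgue_vec d) (order_polytope d A) \<le> 1"
    by (simp add: lebesgue_vec_def emeasure_PiM_lborel_cube)
  then have "emeasure (lebesgue_vec d) (order_polytope d A) \<noteq> \<infinity>"
    by (auto simp: top_unique)
  then show eq: "emeasure (lebesgue_vec d) (order_polytope d A) = ennreal (vol d A)"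
    unfolding vol_def by (intro emeasure_eq_ennreal_measure) auto
  show "vol d A \<le> 1" using le unfolding eq by simp
qed

lemma vol_mono:
  assumes "A \<subseteq> A'" "A' \<subseteq> {1..d} \<times> {1..d}"
  shows "vol d A' \<le> vol d A"
proof -
  have "emeasure (lebesgue_vec d) (order_polytope d A') \<le> emeasure (lebesgue_vec d) (order_polytope d A)"
    using assms by (intro emeasure_mono order_polytope_mono sets_order_polytope) auto
  then show ?thesis
    using assms by (simp add: emeasure_order_polytope vol_def)
qed

text \<open>The arc \<open>(i, j)\<close> confines the new polytope to the part
  \<open>w i \<ge> w j\<close> of the old one. Clearing the common positive volume turns the order
  of the centroid coordinates into the inequality of integrals that \<open>centroid_cut\<close> asks
  for.\<close>

lemma vol_cut:
  assumes A: "A \<subseteq> A'" "A' \<subseteq> {1..d} \<times> {1..d}" and pos: "vol d A > 0"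
    and ij: "(i, j) \<in> A'" "i \<noteq> j"
    and c: "centroid d (order_polytope d A) i \<le> centroid d (order_polytope d A) j"
  shows "vol d A' \<le> 3 / 4 * vol d A"
proof -
  let ?P = "order_polytope d A" and ?M = "lebesgue_vec d"
  have ij_in: "i \<in> {1..d}" "j \<in> {1..d}" and A_sub: "A \<subseteq> {1..d} \<times> {1..d}" using A ij by auto
  have P: "?P \<in> sets ?M" using A_sub by (rule sets_order_polytope)
  have "measure ?M {w \<in> ?P. w i \<ge> w j} \<le> 3 / 4 * measure ?M ?P"
    unfolding lebesgue_vec_def
  proof (rule centroid_cut)
    show "(\<lambda>k\<in>{1..d}. (x k + y k) / 2) \<in> ?P" if "x \<in> ?P" "y \<in> ?P" for x y
      using that A_sub by (fastforce simp: order_polytope_def PiE_iff intro: add_mono)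
    show "(LINT w:?P|(\<Pi>\<^sub>M i\<in>{1..d}. lborel). w i) \<le> (LINT w:?P|(\<Pi>\<^sub>M i\<in>{1..d}. lborel). w j)"
      using c pos ij_in by (simp add: centroid_def vol_def lebesgue_vec_def divide_le_cancel)
  qed (use ij_in ij P pos order_polytope_subset_cube in \<open>auto simp: vol_def lebesgue_vec_def\<close>)
  moreover have "vol d A' \<le> measure ?M {w \<in> ?P. w i \<ge> w j}"
    unfolding vol_def
  proof (rule measure_mono_fmeasurable)
    show "order_polytope d A' \<subseteq> {w \<in> ?P. w j \<le> w i}"
      using A ij by (auto simp: order_polytope_def)
    show "order_polytope d A' \<in> sets ?M" using A(2) by (rule sets_order_polytope)
    have "insert (i, j) A \<subseteq> {1..d} \<times> {1..d}" using A_sub ij_in by auto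
    moreover have "{w \<in> ?P. w j \<le> w i} = order_polytope d (insert (i, j) A)"
      by (auto simp: order_polytope_def)
    ultimately show "{w \<in> ?P. w j \<le> w i} \<in> fmeasurable ?M"
      using emeasure_order_polytope(1) sets_order_polytope by (auto simp: fmeasurable_def)
  qed
  ultimately show ?thesis by (simp add: vol_def)
qed

text \<open>The polytope contains a cube of side \<open>1 / d\<close>: coordinate \<open>k\<close> ranges over the
  interval whose position is the rank of \<open>k\<close> with respect to \<open>ws\<close>.\<close>

lemma vol_ge:
  fixes ws :: "nat \<Rightarrow> real"
  assumes A: "A \<subseteq> {(i, j). i \<in> {1..d} \<and> j \<in> {1..d} \<and> ws i > ws j}" and "d \<ge> 1"
  shows "vol d A \<ge> (1 / real d) ^ d"
proof -
  interpret product_sigma_finite "\<lambda>_. lborel :: real measure" by standard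
  \<comment> \<open>Indices with equal values share a rank. Arcs join only indices with strictly
    ordered values, whose ranks differ by at least 1.\<close>
  define r where "r k = card {l \<in> {1..d}. ws l < ws k}" for k
  have r_less: "r i < d" if "i \<in> {1..d}" for i
  proof -
    have "r i \<le> card ({1..d} - {i})"
      unfolding r_def by (intro card_mono) auto
    then show ?thesis using that by auto
  qed
  have r_mono: "r j < r i" if "(i, j) \<in> A" for i j
  proof -
    have ij: "i \<in> {1..d}" "j \<in> {1..d}" "ws j < ws i" using subsetD[OF A that] by auto
    \<comment> \<open>The index \<open>j\<close> is counted in \<open>r i\<close> but not in
      \<open>r j\<close>, which makes the inequality strict.\<close>
    have "card (insert j {l \<in> {1..d}. ws l < ws j}) \<le> r i"
      unfolding r_def by (intro card_mono) (use ij in auto)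
    then show ?thesis by (simp add: r_def)
  qed
  define Q where "Q = (\<Pi>\<^sub>E k\<in>{1..d}. {real (r k) / d..(real (r k) + 1) / d})"
  have "ennreal ((1 / real d) ^ d) = (\<Prod>k\<in>{1..d}. ennreal (1 / d))"
    by (simp add: ennreal_power)
  also have "\<dots> = (\<Prod>k\<in>{1..d}. emeasure lborel {real (r k) / d..(real (r k) + 1) / d})"
    by (intro prod.cong) (auto simp: divide_right_mono diff_divide_distrib[symmetric])
  also have "\<dots> = emeasure (lebesgue_vec d) Q"
    unfolding Q_def lebesgue_vec_def by (subst emeasure_PiM) auto
  also have "\<dots> \<le> emeasure (lebesgue_vec d) (order_polytope d A)"
  proof (intro emeasure_mono sets_order_polytope)
    show "Q \<subseteq> order_polytope d A"
    proof
      fix w assume w: "w \<in> Q"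
      have "0 \<le> w k \<and> w k \<le> 1" if "k \<in> {1..d}" for k
      proof -
        have "real (r k) / d \<le> w k" "w k \<le> (real (r k) + 1) / d"
          using w that by (auto simp: Q_def PiE_iff)
        moreover have "(real (r k) + 1) / d \<le> 1"
          using r_less[OF that] by (simp add: field_simps)
        moreover have "0 \<le> real (r k) / d" by simp
        ultimately show ?thesis by linarith
      qed
      moreover have "w j \<le> w i" if "(i, j) \<in> A" for i j
      proof -
        have "i \<in> {1..d}" "j \<in> {1..d}" using that A by auto
        then have "w j \<le> (real (r j) + 1) / d" "real (r i) / d \<le> w i"
          using w by (auto simp: Q_def PiE_iff)
        moreover have "(real (r j) + 1) / d \<le> real (r i) / d"
          using r_mono[OF that] by (intro divide_right_mono) auto
        ultimately show ?thesis by linarith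
      qed
      ultimately show "w \<in> order_polytope d A"
        using w by (auto simp: order_polytope_def Q_def PiE_iff)
    qed
  qed (use A in auto)
  finally show ?thesis
    using A by (subst (asm) emeasure_order_polytope) (auto simp: vol_def)
qed

section \<open>Exchange moves and linear objectives\<close>

lemma ip_exch:
  assumes "i \<in> {1..d}" "j \<in> {1..d}"
  shows "ip d w (exch d x i j) = ip d w x - w i + w j"
proof -
  have "ip d w (exch d x i j)
      = (\<Sum>k=1..d. w k * real_of_int (x k) - (if k = i then w k else 0) + (if k = j then w k else 0))"
    unfolding ip_def exch_def by (intro sum.cong) (auto simp: algebra_simps)
  also have "\<dots> = ip d w x - w i + w j"
    using assms by (simp add: ip_def sum.distrib sum_subtractf)
  finally show ?thesis .
qed

lemma ip_diff: "ip d w (\<lambda>i. x i - y i) = ip d w x - ip d w y"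
  by (simp add: ip_def right_diff_distrib sum_subtractf)

text \<open>The exchange changes the objective by \<open>w j - w i\<close>, so optimality gives a
  weak inequality and distinct components make it strict. It is applied to \<open>ws\<close> with
  the observed action and to the prediction with the suggested one.\<close>

lemma exch_inversion:
  assumes max: "is_arg_max (ip d w) (\<lambda>y. y \<in> X) x" and ij: "i \<in> {1..d}" "j \<in> {1..d}" "i \<noteq> j"
    and inj: "inj_on w {1..d}" and "exch d x i j \<in> X"
  shows "w j < w i"
proof -
  have "ip d w (exch d x i j) \<le> ip d w x"
    using assms by (auto simp: is_arg_max_def not_less)
  moreover have "w i \<noteq> w j" using inj ij by (auto dest: inj_onD)
  ultimately show ?thesis using ij by (simp add: ip_exch)
qed

text \<open>Some coordinate differs, and the axiom is applied from whichever vector is larger there.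
  Both cases have the same outcome: \<open>x\<close> moves a unit from \<open>i\<close> to
  \<open>j\<close>, and \<open>y\<close> moves one from \<open>j\<close> to
  \<open>i\<close>.\<close>

lemma M_convex_exchange_pair:
  assumes "M_convex d X" "x \<in> X" "y \<in> X" "x \<noteq> y"
  obtains i j where "i \<in> {1..d}" "j \<in> {1..d}" "i \<noteq> j" "exch d x i j \<in> X" "exch d y j i \<in> X"
proof -
  have ex: "\<exists>j\<in>{1..d}. u j < v j \<and> exch d u i j \<in> X \<and> exch d v j i \<in> X"
    if "u \<in> X" "v \<in> X" "i \<in> {1..d}" "u i > v i" for u v i
    using assms(1) that by (auto simp: M_convex_def)
  have "x \<in> int_vecs d" "y \<in> int_vecs d"
    using assms by (auto simp: M_convex_def)
  then obtain k where k: "k \<in> {1..d}" "x k \<noteq> y k"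
    using \<open>x \<noteq> y\<close> unfolding int_vecs_def by (meson PiE_ext)
  show thesis
  proof (cases "x k > y k")
    case True
    with ex[of x y k] k assms that show ?thesis by fastforce
  next
    case False
    with ex[of y x k] k assms that show ?thesis by fastforce
  qed
qed

section \<open>Perturbations that respect the order of the centroid\<close>

text \<open>A third of the smallest positive gap between coordinates: two coordinates that each move
  this far keep their strict order. The element 1 makes the minimum meaningful when all coordinates
  coincide.\<close>

definition tie_radius :: "nat \<Rightarrow> (nat \<Rightarrow> real) \<Rightarrow> real" where
  "tie_radius d c =
     Min (insert 1 ((\<lambda>(i, j). (c i - c j) / 3) ` {(i, j) \<in> {1..d} \<times> {1..d}. c j < c i}))"

lemma finite_tie_gaps:
  "finite ((\<lambda>(i, j). (c i - c j :: real) / 3) ` {(i, j) \<in> {1..d} \<times> {1..d :: nat}. c j < c i})"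
  by (rule finite_imageI, rule finite_subset[of _ "{1..d} \<times> {1..d}"]) auto

lemma tie_radius_pos: "tie_radius d c > 0"
  unfolding tie_radius_def using finite_tie_gaps[of c d] by (subst Min_gr_iff) auto

lemma tie_radius_le:
  assumes "i \<in> {1..d}" "j \<in> {1..d}" "c j < c i"
  shows "tie_radius d c \<le> (c i - c j) / 3"
  unfolding tie_radius_def using assms finite_tie_gaps[of c d] by (intro Min_le) force+

text \<open>Each coordinate moves by at most the Euclidean distance, so a gap
  \<open>c i - c j > 0\<close> would keep at least a third of its size.\<close>

lemma tie_radius_order:
  assumes ij: "i \<in> {1..d}" "j \<in> {1..d}" and "w i < w j"
    and l2: "L2_set (\<lambda>k. w k - c k) {1..d} \<le> tie_radius d c"
  shows "c i \<le> c j"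
proof (rule ccontr)
  assume "\<not> c i \<le> c j"
  then have "tie_radius d c \<le> (c i - c j) / 3" using ij by (intro tie_radius_le) auto
  moreover have close: "\<bar>w k - c k\<bar> \<le> tie_radius d c" if "k \<in> {1..d}" for k
    using member_le_L2_set[of "{1..d}" k "\<lambda>i. \<bar>w i - c i\<bar>"] that l2
    by (simp add: L2_set_def)
  ultimately show False
    using \<open>\<not> c i \<le> c j\<close> \<open>w i < w j\<close> close[OF ij(1)] close[OF ij(2)]
    by (simp add: abs_le_iff)
qed

section \<open>The potential argument\<close>

text \<open>Regret is charged to the drop of the log-volume; the factor
  \<open>B / ln (4 / 3)\<close> makes one cut to \<open>3 / 4\<close> pay for \<open>B\<close>. The
  inclusion of the arcs in the order of \<open>ws\<close> keeps the volumes positive.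
  \<open>A (Suc n)\<close> is the arc set after round \<open>n\<close>.\<close>

lemma cog_run_potential:
  assumes "d \<ge> 1" and ws: "inj_on ws {1..d}"
    and X: "\<forall>t\<in>{1..T}. M_convex d (X t)"
    and B: "\<forall>t\<in>{1..T}. \<forall>y\<in>X t. \<forall>y'\<in>X t. ip d ws (\<lambda>i. y i - y' i) \<le> B" "B > 0"
    and x: "\<forall>t\<in>{1..T}. is_arg_max (ip d ws) (\<lambda>y. y \<in> X t) (x t)"
    and run: "cog_run d (\<lambda>A. tie_radius d (centroid d (order_polytope d A))) T X x A w xh"
  shows "n \<le> T \<Longrightarrow> A (Suc n) \<subseteq> {(i, j). i \<in> {1..d} \<and> j \<in> {1..d} \<and> ws i > ws j} \<and>
    regret d n ws x xh \<le> B / ln (4 / 3) * - ln (vol d (A (Suc n)))"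
proof (induction n)
  case 0
  have "A 1 = {}" using run by (simp add: cog_run_def)
  \<comment> \<open>Hence \<open>- ln (vol d {})\<close> is non-negative, as the zero regret of the
    empty run requires.\<close>
  moreover have "vol d {} \<le> 1" using emeasure_order_polytope(2)[of "{}" d] by simp
  moreover have "vol d {} > 0"
    using vol_ge[of "{}" d ws] \<open>d \<ge> 1\<close> by (auto intro: less_le_trans[rotated])
  ultimately show ?case
    using \<open>B > 0\<close> by (simp add: regret_def divide_nonpos_pos mult_nonneg_nonpos)
next
  case (Suc n)
  define t where "t = Suc n"
  define P where "P = order_polytope d (A t)"
  let ?E = "{(i, j). i \<in> {1..d} \<and> j \<in> {1..d} \<and> ws i > ws j}"
  have t: "t \<in> {1..T}" using Suc.prems by (simp add: t_def)
  have IH: "A t \<subseteq> ?E" "regret d n ws x xh \<le> B / ln (4 / 3) * - ln (vol d (A t))"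
    using Suc.IH Suc.prems by (simp_all add: t_def)
  have w: "if inj_on (centroid d P) {1..d} then w t = centroid d P
      else w t \<in> P \<and> inj_on (w t) {1..d} \<and> L2_set (\<lambda>i. w t i - centroid d P i) {1..d} \<le> tie_radius d (centroid d P)"
    and xh: "is_arg_max (ip d (w t)) (\<lambda>y. y \<in> X t) (xh t)"
    and A: "A (Suc t) = A t \<union>
      {(i, j). i \<in> {1..d} \<and> j \<in> {1..d} \<and> i \<noteq> j \<and> exch d (x t) i j \<in> X t}"
    using run t unfolding cog_run_def Let_def P_def by blast+
  have xt: "is_arg_max (ip d ws) (\<lambda>y. y \<in> X t) (x t)" using x t by blast
  have E: "A (Suc t) \<subseteq> ?E"
    using IH(1) exch_inversion[OF xt _ _ _ ws] by (auto simp: A)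
  have square: "A t \<subseteq> {1..d} \<times> {1..d}" "A (Suc t) \<subseteq> {1..d} \<times> {1..d}"
    using IH(1) E by auto
  have pos: "vol d (A t) > 0" "vol d (A (Suc t)) > 0"
    using vol_ge[OF IH(1) \<open>d \<ge> 1\<close>] vol_ge[OF E \<open>d \<ge> 1\<close>] \<open>d \<ge> 1\<close>
    by (auto intro: less_le_trans[rotated])
  have regret: "regret d t ws x xh = regret d n ws x xh + ip d ws (\<lambda>i. x t i - xh t i)"
    by (simp add: regret_def t_def)
  have "ip d ws (\<lambda>i. x t i - xh t i) \<le> B / ln (4 / 3) * (ln (vol d (A t)) - ln (vol d (A (Suc t))))"
  proof (cases "x t = xh t")
    case True
    have "vol d (A (Suc t)) \<le> vol d (A t)"
      using A square by (intro vol_mono) auto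
    then show ?thesis
      using True pos \<open>B > 0\<close> by (simp add: ip_def)
  next
    case False
    have inX: "x t \<in> X t" "xh t \<in> X t"
      using xt xh by (auto simp: is_arg_max_def)
    \<comment> \<open>The exchange at \<open>x t\<close> puts the arc \<open>(i, j)\<close> into
      \<open>A (Suc t)\<close>; the reverse exchange at \<open>xh t\<close> shows that the
      prediction ranks \<open>i\<close> below \<open>j\<close>.\<close>
    from X t inX False obtain i j where ij: "i \<in> {1..d}" "j \<in> {1..d}" "i \<noteq> j"
        "exch d (x t) i j \<in> X t" "exch d (xh t) j i \<in> X t"
      by (blast elim: M_convex_exchange_pair)
    have "inj_on (w t) {1..d}" using w by (auto split: if_splits)
    then have "w t i < w t j"
      using exch_inversion[OF xh ij(2,1)] ij by auto
    then have "centroid d P i \<le> centroid d P j"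
      using w tie_radius_order[OF ij(1,2)] by (auto split: if_splits)
    then have "vol d (A (Suc t)) \<le> 3 / 4 * vol d (A t)"
      using ij pos square A by (intro vol_cut) (auto simp: P_def)
    then have "ln (vol d (A (Suc t))) \<le> ln (3 / 4 * vol d (A t))"
      using pos by simp
    also have "\<dots> = ln (vol d (A t)) - ln (4 / 3)"
      using pos by (simp add: ln_mult ln_div)
    finally have "B / ln (4 / 3) * ln (4 / 3)
        \<le> B / ln (4 / 3) * (ln (vol d (A t)) - ln (vol d (A (Suc t))))"
      using \<open>B > 0\<close> by (intro mult_left_mono) auto
    moreover have "ip d ws (\<lambda>i. x t i - xh t i) \<le> B"
      using B t inX by blast
    ultimately show ?thesis by simp
  qed
  with IH(2) E show ?case
    unfolding t_def[symmetric] regret by (simp add: algebra_simps)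
qed

theorem theorem4p2:
  "\<forall>B::real. B > 0 \<longrightarrow> (\<exists>K::real. K > 0 \<and> (\<forall>d::nat. d \<ge> 1 \<longrightarrow>
     (\<exists>\<eta> :: (nat \<times> nat) set \<Rightarrow> real.
        (\<forall>A. A \<subseteq> {1..d} \<times> {1..d} \<and> acyclic A \<longrightarrow> \<eta> A > 0) \<and>
        (\<forall>(T::nat) ws X x A w xh.
           T \<ge> 1 \<and>
           ws \<in> real_vecs d \<and> inj_on ws {1..d} \<and>
           (\<forall>t\<in>{1..T}. M_convex d (X t)) \<and>
           (\<forall>t\<in>{1..T}. \<forall>y\<in>X t. \<forall>y'\<in>X t. ip d ws (\<lambda>i. y i - y' i) \<le> B) \<and>
           (\<forall>t\<in>{1..T}. is_arg_max (ip d ws) (\<lambda>y. y \<in> X t) (x t)) \<and>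
           cog_run d \<eta> T X x A w xh
           \<longrightarrow> regret d T ws x xh \<le> K * real d * ln (real d)))))"
proof -
  have bound: "regret d T ws x xh \<le> B / ln (4 / 3) * real d * ln (real d)"
    if "B > 0" "d \<ge> 1" and ws: "inj_on ws {1..d}" and X: "\<forall>t\<in>{1..T}. M_convex d (X t)"
      and B: "\<forall>t\<in>{1..T}. \<forall>y\<in>X t. \<forall>y'\<in>X t. ip d ws (\<lambda>i. y i - y' i) \<le> B"
      and x: "\<forall>t\<in>{1..T}. is_arg_max (ip d ws) (\<lambda>y. y \<in> X t) (x t)"
      and run: "cog_run d (\<lambda>A. tie_radius d (centroid d (order_polytope d A))) T X x A w xh"
    for B d T ws X x A w xh
  proof -
    note * = cog_run_potential[OF \<open>d \<ge> 1\<close> ws X B \<open>B > 0\<close> x run order_refl]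
    \<comment> \<open>The lower bound on the final volume caps the total drop of the log-volume at
      \<open>d * ln d\<close>, whatever \<open>T\<close> is.\<close>
    have "ln ((1 / real d) ^ d) \<le> ln (vol d (A (Suc T)))"
      using vol_ge[OF conjunct1[OF *] \<open>d \<ge> 1\<close>] \<open>d \<ge> 1\<close> by (intro ln_mono) auto
    then have "- ln (vol d (A (Suc T))) \<le> real d * ln (real d)"
      using \<open>d \<ge> 1\<close> by (simp add: ln_realpow ln_div)
    then have "B / ln (4 / 3) * - ln (vol d (A (Suc T))) \<le> B / ln (4 / 3) * (real d * ln (real d))"
      using \<open>B > 0\<close> by (intro mult_left_mono) auto
    with * show ?thesis
      unfolding mult.assoc by linarith
  qed
  show ?thesis
  proof (intro allI impI, goal_cases)
    case (1 B)
    show ?case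
    proof (intro exI[of _ "B / ln (4 / 3)"] conjI allI impI, goal_cases)
      \<comment> \<open>The radius is a function of the arc set alone, so it is fixed before
        \<open>ws\<close>, the feasible sets and the run.\<close>
      case (2 d)
      with 1 tie_radius_pos bound show ?case
        by (intro exI[of _ "\<lambda>A. tie_radius d (centroid d (order_polytope d A))"]) blast
    qed (use 1 in simp)
  qed
qed

end
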